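(* Let $L$ be a lattice such that each nonempty upper bounded subset of $L$ has a join. Assume that there is an order-preserving increasing action of $\mathbb Z$ on $L$, written additively, such that $$\forall x,y\in L,\ \exists k\in\mathbb N,\quad x-k\le y\le x+k.$$ Let $X$ be the graph with vertex set $L/\mathbb Z$, with an edge between distinct $x,y\in L/\mathbb Z$ if, for some representatives $x_0,y_0$ of $x,y$ in $L$, one has $x_0\le y_0\le x_0+1$ (or the same with the roles of $x$ and $y$ exchanged). Then $X$ is a weakly modular graph.
   Context: The image of $x\in L$ under $n\in\mathbb Z$ is denoted $x+n$; the action is increasing in the sense that $x\le x+1$ for all $x\in L$. $\mathbb N$ contains $0$. A simplicial graph $\Gamma$ is endowed with the path metric $d$ in which every edge has length $1$. $\Gamma$ is weakly modular if for every vertex $x$ of $\Gamma$ and every integer $n\geq 2$ the following hold. (Triangle condition) For any two adjacent vertices $x_1,x_2$ with $d(x,x_1)=d(x,x_2)=n$, there is a vertex $y$ with $d(y,x)=n-1$ and $d(y,x_1)=d(y,x_2)=1$. (Quadrangle condition) For any two vertices $x_1,x_2$ with $d(x,x_1)=d(x,x_2)=n$ and $d(x_1,x_2)=2$ such that $x_1,x_2$ are both adjacent to a common vertex at distance $n+1$ from $x$, there is a vertex $y$ with $d(y,x)=n-1$ and $d(y,x_1)=d(y,x_2)=1$. *)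

theory Defs
  imports
    "HOL-Algebra.Group_Action"
    "HOL-Algebra.Elementary_Groups"
    "HOL-Library.Extended_Nat"
begin

text \<open>A simplicial graph on the vertex set \<open>V\<close> is encoded by its adjacency relation \<open>E\<close>.
  It may be infinite.\<close>

definition simplicial_graph :: "'v set \<Rightarrow> ('v \<times> 'v) set \<Rightarrow> bool" where
  "simplicial_graph V E \<longleftrightarrow> E \<subseteq> V \<times> V \<and> sym E \<and> irrefl E"

text \<open>The least length of an edge path; it is \<open>\<infinity>\<close> when there is no path
  (infimum of the empty set).\<close>

definition path_dist :: "('v \<times> 'v) set \<Rightarrow> 'v \<Rightarrow> 'v \<Rightarrow> enat" where
  "path_dist E x y = (INF n \<in> {n. (x, y) \<in> E ^^ n}. enat n)"

definition triangle_condition :: "'v set \<Rightarrow> ('v \<times> 'v) set \<Rightarrow> bool" where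
  "triangle_condition V E \<longleftrightarrow>
    (\<forall>x\<in>V. \<forall>n::nat. 2 \<le> n \<longrightarrow>
      (\<forall>x1\<in>V. \<forall>x2\<in>V.
        (x1, x2) \<in> E \<and> path_dist E x x1 = enat n \<and> path_dist E x x2 = enat n \<longrightarrow>
        (\<exists>y\<in>V. path_dist E y x = enat (n - 1) \<and>
               path_dist E y x1 = 1 \<and> path_dist E y x2 = 1)))"

definition quadrangle_condition :: "'v set \<Rightarrow> ('v \<times> 'v) set \<Rightarrow> bool" where
  "quadrangle_condition V E \<longleftrightarrow>
    (\<forall>x\<in>V. \<forall>n::nat. 2 \<le> n \<longrightarrow>
      (\<forall>x1\<in>V. \<forall>x2\<in>V.
        path_dist E x x1 = enat n \<and> path_dist E x x2 = enat n \<and> path_dist E x1 x2 = 2 \<and>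
        (\<exists>z\<in>V. (x1, z) \<in> E \<and> (x2, z) \<in> E \<and> path_dist E x z = enat (n + 1)) \<longrightarrow>
        (\<exists>y\<in>V. path_dist E y x = enat (n - 1) \<and>
               path_dist E y x1 = 1 \<and> path_dist E y x2 = 1)))"

text \<open>The finiteness conjunct says that the path metric is a genuine (finite) metric,
  i.e. that the graph is connected.\<close>

definition weakly_modular :: "'v set \<Rightarrow> ('v \<times> 'v) set \<Rightarrow> bool" where
  "weakly_modular V E \<longleftrightarrow>
    simplicial_graph V E \<and>
    (\<forall>x\<in>V. \<forall>y\<in>V. path_dist E x y \<noteq> \<infinity>) \<and>
    triangle_condition V E \<and> quadrangle_condition V E"

text \<open>For an action \<open>\<phi>\<close> of the integers, \<open>\<phi> n x\<close> is the element written \<open>x + n\<close>.\<close>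

definition quotient_vertices :: "(int \<Rightarrow> 'a \<Rightarrow> 'a) \<Rightarrow> 'a set set" where
  "quotient_vertices \<phi> = orbits integer_group UNIV \<phi>"

definition quotient_edges :: "(int \<Rightarrow> 'a::order \<Rightarrow> 'a) \<Rightarrow> ('a set \<times> 'a set) set" where
  "quotient_edges \<phi> =
    {(x, y). x \<in> quotient_vertices \<phi> \<and> y \<in> quotient_vertices \<phi> \<and> x \<noteq> y \<and>
      (\<exists>x0\<in>x. \<exists>y0\<in>y. (x0 \<le> y0 \<and> y0 \<le> \<phi> 1 x0) \<or> (y0 \<le> x0 \<and> x0 \<le> \<phi> 1 y0))}"

end

theory Submission
  imports Defs
begin

text \<open>Distances in the quotient are read off in the lattice: the classes of \<open>a\<close> and \<open>b\<close> are at
  distance at most \<open>n\<close> iff \<open>a \<le> b + j \<le> a + n\<close> for some \<open>j\<close>; a path is given by the elements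
  \<open>(a + i) \<sqinter> (b + j)\<close>. If the distance is exactly \<open>n\<close>, the representative \<open>b + j\<close> in \<open>[a, a + n]\<close>
  is unique. In both conditions this forces the representatives \<open>b, c \<in> [a, a + n]\<close> of the two given
  vertices to satisfy \<open>b \<le> c + 1\<close> and \<open>c \<le> b + 1\<close>, and then the class of
  \<open>b \<sqinter> c \<sqinter> (a + (n - 1))\<close> is the required vertex.\<close>

section \<open>Path distance in an arbitrary relation\<close>

lemma path_dist_le_iff:
  "path_dist E x y \<le> enat n \<longleftrightarrow> (\<exists>m\<le>n. (x, y) \<in> E ^^ m)"
proof
  let ?A = "enat ` {n. (x, y) \<in> E ^^ n}"
  assume le: "path_dist E x y \<le> enat n"
  \<comment> \<open>An empty set would have infimum \<open>\<infinity>\<close>. A nonempty one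
    attains its infimum, so the distance is the length of an actual path.\<close>
  then have "?A \<noteq> {}"
    unfolding path_dist_def by (metis Inf_empty enat_ord_code(3) infinity_ileE top_enat_def)
  then have "Inf ?A \<in> ?A"
    unfolding Inf_enat_def by (simp only: if_False) (meson LeastI_ex ex_in_conv)
  with le show "\<exists>m\<le>n. (x, y) \<in> E ^^ m"
    by (auto simp: path_dist_def)
next
  assume "\<exists>m\<le>n. (x, y) \<in> E ^^ m"
  then obtain m where "m \<le> n" "(x, y) \<in> E ^^ m" by blast
  then show "path_dist E x y \<le> enat n"
    unfolding path_dist_def by (intro INF_lower2[of m]) auto
qed

text \<open>Reduces exact distances to upper bounds, the form that translates into inequalities in
  the lattice.\<close>

lemma path_dist_eq_Suc_iff:
  "path_dist E x y = enat (Suc n) \<longleftrightarrow>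
    path_dist E x y \<le> enat (Suc n) \<and> \<not> path_dist E x y \<le> enat n"
  by (cases "path_dist E x y") auto

lemma path_dist_edge:
  assumes "(x, y) \<in> E" "x \<noteq> y"
  shows "path_dist E x y = 1"
proof -
  have "path_dist E x y = enat (Suc 0)"
    using assms by (subst path_dist_eq_Suc_iff) (auto simp: path_dist_le_iff intro!: exI[of _ 1])
  then show ?thesis by (simp add: one_enat_def)
qed

section \<open>Increasing integer actions on a lattice\<close>

locale increasing_int_action =
  fixes \<phi> :: "int \<Rightarrow> 'a::lattice \<Rightarrow> 'a"
  assumes act_add: "\<phi> m (\<phi> n x) = \<phi> (m + n) x"
    and act_zero [simp]: "\<phi> 0 x = x"
    and act_mono: "x \<le> y \<Longrightarrow> \<phi> n x \<le> \<phi> n y"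
    and act_increasing: "x \<le> \<phi> 1 x"
begin

lemma act_le_iff: "\<phi> m x \<le> \<phi> n y \<longleftrightarrow> x \<le> \<phi> (n - m) y"
  using act_mono[of "\<phi> m x" "\<phi> n y" "- m"] act_mono[of x "\<phi> (n - m) y" m]
  by (auto simp: act_add)

lemma act_le_left_iff: "\<phi> m x \<le> y \<longleftrightarrow> x \<le> \<phi> (- m) y"
  using act_le_iff[of m x 0 y] by simp

lemma act_mono_index:
  assumes "m \<le> n"
  shows "\<phi> m x \<le> \<phi> n x"
  using assms
proof (induction n rule: int_ge_induct)
  case (step i)
  have "\<phi> i x \<le> \<phi> (i + 1) x"
    using act_increasing[of "\<phi> i x"] by (simp add: act_add add.commute)
  with step.IH show ?case by (rule order_trans)
qed simp

text \<open>Shifted back by \<open>n\<close>, the element \<open>z\<close> is a lower bound of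
  \<open>x\<close> and \<open>y\<close>.\<close>

lemma le_act_inf: "z \<le> \<phi> n x \<Longrightarrow> z \<le> \<phi> n y \<Longrightarrow> z \<le> \<phi> n (inf x y)"
  by (metis act_le_left_iff le_inf_iff minus_minus)

section \<open>Quotient vertices, edges and distances through representatives\<close>

definition cls :: "'a \<Rightarrow> 'a set" where
  "cls a = range (\<lambda>j. \<phi> j a)"

definition near :: "nat \<Rightarrow> 'a \<Rightarrow> 'a \<Rightarrow> bool" where
  "near n a b \<longleftrightarrow> (\<exists>j. a \<le> \<phi> j b \<and> \<phi> j b \<le> \<phi> (int n) a)"

lemma quotient_vertices_eq: "quotient_vertices \<phi> = range cls"
  by (auto simp: quotient_vertices_def orbits_def orbit_def cls_def integer_group_def image_def)

lemma cls_act [simp]: "cls (\<phi> j a) = cls a"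
proof -
  have "\<phi> k a \<in> range (\<lambda>i. \<phi> (i + j) a)" for k
    by (rule range_eqI[of _ _ "k - j"]) simp
  then show ?thesis by (auto simp: cls_def act_add)
qed

text \<open>Shifting \<open>a \<le> b + j \<le> a + n\<close> by \<open>n - j\<close> or
  \<open>- j\<close> gives \<open>b \<le> a + (n - j) \<le> b + n\<close>.\<close>

lemma near_commute: "near n a b \<longleftrightarrow> near n b a"
proof -
  have "near n b a" if "near n a b" for a b
  proof -
    from that obtain j where "a \<le> \<phi> j b" "\<phi> j b \<le> \<phi> (int n) a"
      by (auto simp: near_def)
    then show ?thesis
      by (auto simp: near_def act_le_iff intro!: exI[of _ "int n - j"])
  qed
  then show ?thesis by blast
qed

lemma edge_iff:
  "(cls a, cls b) \<in> quotient_edges \<phi> \<longleftrightarrow> cls a \<noteq> cls b \<and> near 1 a b"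
proof -
  have "near 1 a b" if "\<phi> i a \<le> \<phi> j b" "\<phi> j b \<le> \<phi> 1 (\<phi> i a)" for a b i j
    unfolding near_def using that
    by (intro exI[of _ "j - i"]) (auto simp: act_add act_le_iff algebra_simps)
  then have "near 1 a b" if "(cls a, cls b) \<in> quotient_edges \<phi>"
    using that near_commute[of 1 a b] by (fastforce simp: quotient_edges_def cls_def)
  moreover have "(cls a, cls b) \<in> quotient_edges \<phi>" if "cls a \<noteq> cls b" "near 1 a b"
  proof -
    from that obtain j where "a \<le> \<phi> j b" "\<phi> j b \<le> \<phi> 1 a" by (auto simp: near_def)
    moreover have "a \<in> cls a"
      unfolding cls_def by (rule range_eqI[of _ _ 0]) simp
    moreover have "\<phi> j b \<in> cls b"
      by (simp add: cls_def)
    ultimately show ?thesis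
      using that(1) unfolding quotient_edges_def quotient_vertices_eq by blast
  qed
  ultimately show ?thesis by (auto simp: quotient_edges_def)
qed

lemma near_trans:
  assumes "near m a b" "near n b c"
  shows "near (m + n) a c"
proof -
  obtain i j where "a \<le> \<phi> i b" "\<phi> i b \<le> \<phi> (int m) a" "b \<le> \<phi> j c" "\<phi> j c \<le> \<phi> (int n) b"
    using assms by (auto simp: near_def)
  then have "\<phi> i b \<le> \<phi> (i + j) c" "\<phi> (i + j) c \<le> \<phi> (int n + i) b"
    "\<phi> (int n + i) b \<le> \<phi> (int m + int n) a"
    by (simp_all add: act_le_iff)
  with \<open>a \<le> \<phi> i b\<close> show ?thesis
    by (auto simp: near_def intro!: exI[of _ "i + j"] intro: order_trans)
qed

lemma near_mono:
  assumes "near m a b" "m \<le> n"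
  shows "near n a b"
  using assms act_mono_index[of "int m" "int n" a] by (auto simp: near_def intro: order_trans)

lemma near_if_path: "(cls a, cls b) \<in> quotient_edges \<phi> ^^ n \<Longrightarrow> near n a b"
proof (induction n arbitrary: b)
  case 0
  moreover have "a \<in> cls a"
    unfolding cls_def by (rule range_eqI[of _ _ 0]) simp
  ultimately have "a \<in> cls b"
    by simp
  then show ?case by (auto simp: cls_def near_def)
next
  case (Suc n)
  then obtain z where z: "(cls a, z) \<in> quotient_edges \<phi> ^^ n" "(z, cls b) \<in> quotient_edges \<phi>"
    by auto
  then obtain c where "z = cls c"
    by (auto simp: quotient_edges_def quotient_vertices_eq)
  with z Suc.IH[of c] show ?case
    using near_trans[of n a c 1 b] by (simp add: edge_iff)
qed

text \<open>The length is only bounded by \<open>n\<close>, because successive elements of the chain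
  may lie in the same class, which yields no edge.\<close>

lemma path_if_near:
  assumes "a \<le> b" "b \<le> \<phi> (int n) a"
  shows "\<exists>m\<le>n. (cls a, cls b) \<in> quotient_edges \<phi> ^^ m"
  using assms
proof (induction n arbitrary: b)
  case 0
  then show ?case by (auto dest: antisym)
next
  case (Suc n)
  \<comment> \<open>Truncating \<open>b\<close> at \<open>a + n\<close> gives the last vertex before
    \<open>b\<close>. Both \<open>a + n\<close> and \<open>b\<close> have a translate by 1 above
    \<open>b\<close>, hence so does \<open>c\<close>.\<close>
  define c where "c = inf (\<phi> (int n) a) b"
  have "a \<le> c" "c \<le> \<phi> (int n) a" "c \<le> b"
    using Suc.prems act_mono_index[of 0 "int n" a] by (auto simp: c_def)
  then obtain m where m: "m \<le> n" "(cls a, cls c) \<in> quotient_edges \<phi> ^^ m"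
    using Suc.IH by blast
  have "b \<le> \<phi> 1 c"
    unfolding c_def using Suc.prems act_increasing by (intro le_act_inf) (auto simp: act_add)
  with \<open>c \<le> b\<close> have "near 1 c b"
    by (auto simp: near_def intro!: exI[of _ 0])
  then have "cls c = cls b \<or> (cls c, cls b) \<in> quotient_edges \<phi>"
    by (auto simp: edge_iff)
  with m show ?case
    by (metis Suc_le_mono le_SucI relpow_Suc_I)
qed

text \<open>The left side involves only classes, so this also shows that \<open>near\<close> does
  not depend on the representatives.\<close>

lemma path_dist_cls_le_iff:
  "path_dist (quotient_edges \<phi>) (cls a) (cls b) \<le> enat n \<longleftrightarrow> near n a b"
proof
  assume "near n a b"
  then obtain j where "a \<le> \<phi> j b" "\<phi> j b \<le> \<phi> (int n) a"
    by (auto simp: near_def)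
  then show "path_dist (quotient_edges \<phi>) (cls a) (cls b) \<le> enat n"
    using path_if_near[of a "\<phi> j b" n] by (simp add: path_dist_le_iff)
qed (auto simp: path_dist_le_iff intro: near_mono dest!: near_if_path)

section \<open>Exact distances and the two modularity conditions\<close>

lemma path_dist_cls_eq_Suc_iff:
  "path_dist (quotient_edges \<phi>) (cls a) (cls b) = enat (Suc n) \<longleftrightarrow> near (Suc n) a b \<and> \<not> near n a b"
  by (subst path_dist_eq_Suc_iff) (simp add: path_dist_cls_le_iff)

text \<open>Shifts 0 and -1 in the negated \<open>near\<close> rule out
  \<open>b' \<le> \<phi> (int n) a\<close> and \<open>\<phi> 1 a \<le> b'\<close>, which makes
  \<open>b'\<close> unique.\<close>

lemma representative_at_dist:
  assumes "path_dist (quotient_edges \<phi>) (cls a) (cls b) = enat (Suc n)"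
  obtains b' where "cls b' = cls b" "a \<le> b'" "b' \<le> \<phi> (int (Suc n)) a"
    "\<not> near n a b'"
proof -
  from assms obtain j where "a \<le> \<phi> j b" "\<phi> j b \<le> \<phi> (int (Suc n)) a" "\<not> near n a b"
    by (auto simp: path_dist_cls_eq_Suc_iff near_def)
  moreover have "near n a (\<phi> j b) \<longleftrightarrow> near n a b"
    by (simp flip: path_dist_cls_le_iff)
  ultimately show thesis by (intro that[of "\<phi> j b"]) auto
qed

lemma gate:
  assumes b: "a \<le> b" "b \<le> \<phi> (int (Suc (Suc n))) a" "\<not> near (Suc n) a b"
    and c: "a \<le> c" "c \<le> \<phi> (int (Suc (Suc n))) a" "\<not> near (Suc n) a c"
    and bc: "b \<le> \<phi> 1 c" "c \<le> \<phi> 1 b"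
  defines "E \<equiv> quotient_edges \<phi>"
  shows "\<exists>y\<in>quotient_vertices \<phi>. path_dist E y (cls a) = enat (Suc n) \<and>
    path_dist E y (cls b) = 1 \<and> path_dist E y (cls c) = 1"
proof -
  define y where "y = inf (inf b c) (\<phi> (int (Suc n)) a)"
  have y: "a \<le> y" "y \<le> \<phi> (int (Suc n)) a"
    using b(1) c(1) act_mono_index[of 0 "int (Suc n)" a] by (auto simp: y_def)
  then have near_ay: "near (Suc n) a y"
    by (auto simp: near_def intro!: exI[of _ 0])
  have adj: "near 1 y u \<and> path_dist E (cls y) (cls u) = 1"
    if "u \<in> {b, c}" for u
  proof -
    \<comment> \<open>Each of \<open>b\<close>, \<open>c\<close> and \<open>a + (n + 1)\<close> has
      a translate by 1 above \<open>u\<close>, so the meet \<open>y\<close> does too.\<close>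
    have "y \<le> u" "u \<le> \<phi> 1 y"
      unfolding y_def using that b c bc act_increasing
      by (auto intro!: le_act_inf simp: act_add le_infI1 add.commute)
    then have "near 1 y u"
      by (auto simp: near_def intro!: exI[of _ 0])
    moreover have "cls y \<noteq> cls u"
      using near_ay b(3) c(3) that by (auto simp flip: path_dist_cls_le_iff)
    ultimately show ?thesis
      unfolding E_def by (simp add: edge_iff path_dist_edge)
  qed
  \<comment> \<open>Otherwise \<open>b\<close>, adjacent to \<open>y\<close>, would be within
    \<open>n + 1\<close> of \<open>a\<close>.\<close>
  have "\<not> near n a y"
    using near_trans[of n a y 1 b] adj[of b] b(3) by auto
  with near_ay have "path_dist E (cls y) (cls a) = enat (Suc n)"
    unfolding E_def by (simp add: path_dist_cls_eq_Suc_iff near_commute[of _ y])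
  then show ?thesis
    using adj by (auto simp: quotient_vertices_eq)
qed

lemma triangle_condition_quotient: "triangle_condition (quotient_vertices \<phi>) (quotient_edges \<phi>)"
proof -
  let ?V = "quotient_vertices \<phi>" and ?E = "quotient_edges \<phi>"
  have "\<exists>y\<in>?V. path_dist ?E y x = enat (n - 1) \<and> path_dist ?E y x1 = 1 \<and> path_dist ?E y x2 = 1"
    if V: "x \<in> ?V" "x1 \<in> ?V" "x2 \<in> ?V" and "2 \<le> n" and E: "(x1, x2) \<in> ?E"
      and d: "path_dist ?E x x1 = enat n" "path_dist ?E x x2 = enat n" for x n x1 x2
  proof -
    obtain m where n: "n = Suc (Suc m)"
      using \<open>2 \<le> n\<close> by (metis Suc_le_D numeral_2_eq_2 Suc_le_mono)
    obtain a where x: "x = cls a"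
      using V by (auto simp: quotient_vertices_eq)
    obtain b where b: "x1 = cls b" "a \<le> b" "b \<le> \<phi> (int (Suc (Suc m))) a" "\<not> near (Suc m) a b"
      using V d(1) unfolding x n quotient_vertices_eq by (metis representative_at_dist rangeE)
    obtain c where c: "x2 = cls c" "a \<le> c" "c \<le> \<phi> (int (Suc (Suc m))) a" "\<not> near (Suc m) a c"
      using V d(2) unfolding x n quotient_vertices_eq by (metis representative_at_dist rangeE)
    obtain j where j: "b \<le> \<phi> j c" "\<phi> j c \<le> \<phi> 1 b"
      using E b c by (auto simp: edge_iff near_def)
    \<comment> \<open>The edge provides an unknown shift \<open>j\<close>; only 0 and 1 are
      possible. If \<open>j \<ge> 2\<close>, then \<open>c + 1 \<le> b\<close>, and \<open>c\<close>
      would lie below \<open>a + (m + 1)\<close>; if \<open>j < 0\<close>, then \<open>b\<close>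
      would.\<close>
    have "j < 2"
    proof (rule ccontr)
      assume "\<not> j < 2"
      then have "\<phi> 1 c \<le> \<phi> (j - 1) c"
        by (intro act_mono_index) simp
      also have "\<dots> \<le> b"
        using j(2) by (simp add: act_le_left_iff act_add)
      finally have "\<phi> 1 c \<le> \<phi> (int (Suc (Suc m))) a"
        using b(3) by (rule order_trans)
      then have "c \<le> \<phi> (int (Suc m)) a"
        by (simp add: act_le_iff)
      then show False
        using c by (auto simp: near_def dest: spec[of _ 0])
    qed
    have "j > - 1"
    proof (rule ccontr)
      assume "\<not> j > - 1"
      then have "b \<le> \<phi> (- 1) c"
        using j(1) act_mono_index[of j "- 1" c] by simp
      also have "\<dots> \<le> \<phi> (int (Suc m)) a"
        using c(3) by (simp add: act_le_iff add.commute)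
      finally show False
        using b by (auto simp: near_def dest: spec[of _ 0])
    qed
    have "b \<le> \<phi> 1 c"
      using j(1) act_mono_index[of j 1 c] \<open>j < 2\<close> by simp
    moreover have "c \<le> \<phi> 1 b"
      using j(2) act_mono_index[of 0 j c] \<open>j > - 1\<close> by simp
    ultimately show ?thesis
      using gate[of a b m c] b c x n by simp
  qed
  then show ?thesis unfolding triangle_condition_def by blast
qed

text \<open>If \<open>b\<close> is adjacent to \<open>e\<close> and one step closer to \<open>a\<close>, their adjacency is realised, with this
  orientation, by their unique representatives near \<open>a\<close>.\<close>

lemma closer_neighbour_le:
  assumes e: "a \<le> e" "e \<le> \<phi> (int (Suc n)) a" "\<not> near n a e"
    and b: "a \<le> b" "b \<le> \<phi> (int n) a" and adj: "near 1 b e"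
  shows "b \<le> e" "e \<le> \<phi> 1 b"
proof -
  obtain j where j: "b \<le> \<phi> j e" "\<phi> j e \<le> \<phi> 1 b"
    using adj by (auto simp: near_def)
  \<comment> \<open>A positive \<open>j\<close> would put \<open>e\<close> below
    \<open>a + n\<close>, and a negative one would put \<open>e - 1\<close> between \<open>a\<close>
    and \<open>a + n\<close>.\<close>
  have "j = 0"
  proof (rule ccontr)
    assume "j \<noteq> 0"
    then consider "1 \<le> j" | "j \<le> - 1" by linarith
    then show False
    proof cases
      case 1
      have "\<phi> 1 e \<le> \<phi> 1 b"
        using j(2) act_mono_index[OF 1, of e] by simp
      then have "e \<le> \<phi> (int n) a"
        using b(2) by (simp add: act_le_iff)
      with e(1,3) show False
        by (auto simp: near_def dest: spec[of _ 0])
    next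
      case 2
      have "a \<le> \<phi> (- 1) e"
        using b(1) j(1) act_mono_index[OF 2, of e] by (meson order_trans)
      moreover have "\<phi> (- 1) e \<le> \<phi> (int n) a"
        using e(2) by (simp add: act_le_iff add.commute)
      ultimately show False
        using e(3) by (auto simp: near_def)
    qed
  qed
  with j show "b \<le> e" "e \<le> \<phi> 1 b" by auto
qed

lemma quadrangle_condition_quotient: "quadrangle_condition (quotient_vertices \<phi>) (quotient_edges \<phi>)"
proof -
  let ?V = "quotient_vertices \<phi>" and ?E = "quotient_edges \<phi>"
  have "\<exists>y\<in>?V. path_dist ?E y x = enat (n - 1) \<and> path_dist ?E y x1 = 1 \<and> path_dist ?E y x2 = 1"
    if V: "x \<in> ?V" "x1 \<in> ?V" "x2 \<in> ?V" "z \<in> ?V" and "2 \<le> n"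
      and E: "(x1, z) \<in> ?E" "(x2, z) \<in> ?E"
      and d: "path_dist ?E x x1 = enat n" "path_dist ?E x x2 = enat n"
        "path_dist ?E x z = enat (n + 1)" for x n x1 x2 z
  proof -
    obtain m where n: "n = Suc (Suc m)"
      using \<open>2 \<le> n\<close> by (metis Suc_le_D numeral_2_eq_2 Suc_le_mono)
    obtain a where x: "x = cls a"
      using V by (auto simp: quotient_vertices_eq)
    obtain b where b: "x1 = cls b" "a \<le> b" "b \<le> \<phi> (int (Suc (Suc m))) a" "\<not> near (Suc m) a b"
      using V d(1) unfolding x n quotient_vertices_eq by (metis representative_at_dist rangeE)
    obtain c where c: "x2 = cls c" "a \<le> c" "c \<le> \<phi> (int (Suc (Suc m))) a" "\<not> near (Suc m) a c"
      using V d(2) unfolding x n quotient_vertices_eq by (metis representative_at_dist rangeE)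
    obtain e where e: "z = cls e" "a \<le> e" "e \<le> \<phi> (int (Suc n)) a" "\<not> near n a e"
      using V d(3) unfolding x quotient_vertices_eq
      by (metis representative_at_dist rangeE Suc_eq_plus1)
    have "b \<le> e \<and> e \<le> \<phi> 1 b" "c \<le> e \<and> e \<le> \<phi> 1 c"
      using closer_neighbour_le[OF e(2-4)] E b c n by (auto simp: e(1) edge_iff)
    \<comment> \<open>Both inequalities pass through \<open>e\<close>:
      \<open>b \<le> e \<le> c + 1\<close> and \<open>c \<le> e \<le> b + 1\<close>.\<close>
    then have "b \<le> \<phi> 1 c" "c \<le> \<phi> 1 b"
      by (meson order_trans)+
    then show ?thesis
      using gate[of a b m c] b c x n by simp
  qed
  then show ?thesis unfolding quadrangle_condition_def by blast
qed

end

theorem theorem2p1: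
  fixes \<phi> :: "int \<Rightarrow> 'a::lattice \<Rightarrow> 'a"
  assumes joins: "\<And>S :: 'a set. S \<noteq> {} \<Longrightarrow> bdd_above S \<Longrightarrow>
      \<exists>s. (\<forall>x\<in>S. x \<le> s) \<and> (\<forall>u. (\<forall>x\<in>S. x \<le> u) \<longrightarrow> s \<le> u)"
    and action: "group_action integer_group (UNIV :: 'a set) \<phi>"
    and order_preserving: "\<And>n. mono (\<phi> n)"
    and increasing: "\<And>x. x \<le> \<phi> 1 x"
    and cofinal: "\<And>x y. \<exists>k::nat. \<phi> (- int k) x \<le> y \<and> y \<le> \<phi> (int k) x"
  shows "weakly_modular (quotient_vertices \<phi>) (quotient_edges \<phi>)"
proof -
  interpret increasing_int_action \<phi>
  proof
    show "\<phi> m (\<phi> n x) = \<phi> (m + n) x" for m n x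
      using group_action.composition_rule[OF action, of x m n] by simp
    show "\<phi> 0 x = x" for x
      using group_action.id_eq_one[OF action] by (metis UNIV_I one_integer_group restrict_apply')
  qed (use order_preserving increasing in \<open>auto dest: monoD\<close>)
  \<comment> \<open>Shifting \<open>a - k \<le> b \<le> a + k\<close> by \<open>k\<close> puts
    \<open>b + k\<close> between \<open>a\<close> and \<open>a + 2k\<close>; connectedness
    follows.\<close>
  have "near (2 * k) a b"
    if "\<phi> (- int k) a \<le> b" "b \<le> \<phi> (int k) a" for a b k
    using that by (auto simp: near_def act_le_left_iff act_add intro!: exI[of _ "int k"])
  then have "\<exists>n. near n a b" for a b
    using cofinal by blast
  then have "path_dist (quotient_edges \<phi>) (cls a) (cls b) \<noteq> \<infinity>" for a b
    by (metis path_dist_cls_le_iff enat_ord_simps(5) infinity_ne_i0 enat.distinct(2))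
  moreover have "simplicial_graph (quotient_vertices \<phi>) (quotient_edges \<phi>)"
    by (auto simp: simplicial_graph_def quotient_edges_def sym_def irrefl_def)
  ultimately show ?thesis
    using triangle_condition_quotient quadrangle_condition_quotient
    by (auto simp: weakly_modular_def quotient_vertices_eq)
qed

end
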